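(* Let $A=A(P_7)$ be the adjacency matrix of the path $P_7$. Then \[ \mathcal K(A(P_7);2,6)=\{2\}, \] and the minimum positive transfer time from vertex $2$ to vertex $6$ under $A^2$ is $\pi/\sqrt2$.
   Context: $P_n$ is the path with vertices $1,2,\ldots,n$, where $i$ and $j$ are adjacent iff $|i-j|=1$. A real symmetric matrix $K$ indexed by a finite vertex set has perfect state transfer (PST) from vertex $a$ to vertex $b$ at time $\tau>0$ (a transfer time) if $\exp(-\mathrm i\tau K)e_a=\gamma e_b$ for some $\gamma\in\mathbb C$ with $|\gamma|=1$, where $e_v$ is the standard basis vector indexed by $v$; it has PST from $a$ to $b$ if this holds for some $\tau>0$. $\mathcal K(A;a,b)=\{k\in\{1,2,3,\ldots\}:A^k\text{ has PST from }a\text{ to }b\}$. *)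

theory Defs
  imports "Jordan_Normal_Form.Matrix" Complex_Main
begin

text \<open>
  Graphs on the vertex set \<open>{1..n}\<close> are given by their adjacency relation.
  Library matrices are indexed from \<open>0\<close>, so vertex \<open>v\<close> corresponds to row and column \<open>v - 1\<close>
  throughout.
\<close>

definition path_adj :: "nat \<Rightarrow> nat \<Rightarrow> bool" where
  "path_adj i j \<longleftrightarrow> \<bar>int i - int j\<bar> = 1"

definition adjacency_mat :: "nat \<Rightarrow> (nat \<Rightarrow> nat \<Rightarrow> bool) \<Rightarrow> real mat" where
  "adjacency_mat n E = mat n n (\<lambda>(i, j). if E (i + 1) (j + 1) then 1 else 0)"

definition path_mat :: "nat \<Rightarrow> real mat" where
  "path_mat n = adjacency_mat n path_adj"

definition vertex_vec :: "nat \<Rightarrow> nat \<Rightarrow> complex vec" where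
  "vertex_vec n v = unit_vec n (v - 1)"

text \<open>
  The matrix type carries no topology, so the exponential series is summed entrywise;
  for a square matrix every entry series converges absolutely.
\<close>

definition exp_mat :: "complex mat \<Rightarrow> complex mat" where
  "exp_mat M = mat (dim_row M) (dim_row M)
     (\<lambda>(i, j). \<Sum>k. (M ^\<^sub>m k) $$ (i, j) / fact k)"

text \<open>
  The condition \<open>a, b \<in> {1..n}\<close> also rules out the label \<open>0\<close>, which truncated subtraction in
  \<^const>\<open>vertex_vec\<close> would identify with vertex \<open>1\<close>.
\<close>

definition pst_at :: "real mat \<Rightarrow> nat \<Rightarrow> nat \<Rightarrow> real \<Rightarrow> bool" where
  "pst_at K a b \<tau> \<longleftrightarrow>
     (let n = dim_row K in
        K \<in> carrier_mat n n \<and> transpose_mat K = K \<and> a \<in> {1..n} \<and> b \<in> {1..n} \<and> \<tau> > 0 \<and>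
        (\<exists>\<gamma>::complex. cmod \<gamma> = 1 \<and>
           exp_mat ((- \<i> * complex_of_real \<tau>) \<cdot>\<^sub>m map_mat complex_of_real K) *\<^sub>v vertex_vec n a
             = \<gamma> \<cdot>\<^sub>v vertex_vec n b))"

definition pst :: "real mat \<Rightarrow> nat \<Rightarrow> nat \<Rightarrow> bool" where
  "pst K a b \<longleftrightarrow> (\<exists>\<tau>. pst_at K a b \<tau>)"

definition pst_powers :: "real mat \<Rightarrow> nat \<Rightarrow> nat \<Rightarrow> nat set" where
  "pst_powers A a b = {k. k \<ge> 1 \<and> pst (A ^\<^sub>m k) a b}"

end

theory Submission
  imports Defs "HOL-Computational_Algebra.Primes"
begin

text \<open>
  If \<open>w\<close> is an eigenvector of the symmetric matrix \<open>K\<close> with eigenvalue \<open>\<theta>\<close>, state transfer from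
  \<open>a\<close> to \<open>b\<close> at time \<open>\<tau>\<close> forces \<open>cis (- \<tau> \<theta>) * w a = \<gamma> * w b\<close>. For \<open>P\<^sub>7\<close> the eigenvectors
  \<open>sin (v x)\<close> with \<open>x = \<pi>/8, \<pi>/4, 3\<pi>/8\<close> and their reflections \<open>\<pi> - x\<close> show that, up to sign, all
  phases at \<open>\<plusminus>(2 cos x)\<^sup>k\<close> agree. For odd \<open>k\<close> this makes \<open>(2 cos (\<pi>/8) / 2 cos (3\<pi>/8))\<^sup>k = (1 + \<surd>2)\<^sup>k\<close>
  rational, and for \<open>k = 2m\<close> with \<open>m \<ge> 2\<close> it makes the ratio of the gaps between \<open>(2 + \<surd>2)\<^sup>m\<close>, \<open>2\<^sup>m\<close>
  and \<open>(2 - \<surd>2)\<^sup>m\<close> rational; both are impossible. For \<open>k = 2\<close> both gaps equal \<open>\<surd>2\<close>.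
\<close>

section \<open>The matrix exponential on eigenvectors\<close>

text \<open>A crude geometric bound, good enough for comparison with the exponential series of
  \<open>real n * B\<close>: each further factor \<open>M\<close> sums \<open>n\<close> products and
  so costs at most a factor \<open>n * B\<close>.\<close>

lemma pow_mat_index_bound:
  fixes M :: "complex mat"
  assumes M: "M \<in> carrier_mat n n"
    and B: "\<And>i j. i < n \<Longrightarrow> j < n \<Longrightarrow> cmod (M $$ (i, j)) \<le> B"
    and "i < n" "j < n"
  shows "cmod ((M ^\<^sub>m k) $$ (i, j)) \<le> (real n * B) ^ k"
  using assms(3,4)
proof (induction k arbitrary: j)
  case 0
  then show ?case using M by (auto simp: one_mat_def)
next
  case (Suc k)
  have Mk: "M ^\<^sub>m k \<in> carrier_mat n n" using M by simp
  have "B \<ge> 0" using B[OF Suc.prems] norm_ge_zero order_trans by blast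
  have "(M ^\<^sub>m Suc k) $$ (i, j) = (\<Sum>l<n. (M ^\<^sub>m k) $$ (i, l) * M $$ (l, j))"
    using Mk M Suc.prems by (auto simp: scalar_prod_def atLeast0LessThan)
  also have "cmod \<dots> \<le> (\<Sum>l<n. (real n * B) ^ k * B)"
  proof (rule sum_norm_le)
    fix l assume "l \<in> {..<n}"
    then show "cmod ((M ^\<^sub>m k) $$ (i, l) * M $$ (l, j)) \<le> (real n * B) ^ k * B"
      unfolding norm_mult using Suc B \<open>B \<ge> 0\<close> by (intro mult_mono) auto
  qed
  also have "\<dots> = (real n * B) ^ Suc k" by simp
  finally show ?case .
qed

lemma summable_exp_mat_index:
  fixes M :: "complex mat"
  assumes M: "M \<in> carrier_mat n n" and ij: "i < n" "j < n"
  shows "summable (\<lambda>k. (M ^\<^sub>m k) $$ (i, j) / fact k)"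
proof -
  \<comment> \<open>The sum of all entry norms is a convenient bound for every single entry.\<close>
  define B where "B = (\<Sum>(i, j) \<in> {..<n} \<times> {..<n}. cmod (M $$ (i, j)))"
  have B: "cmod (M $$ (i, j)) \<le> B" if "i < n" "j < n" for i j
    unfolding B_def using that
      member_le_sum[of "(i, j)" "{..<n} \<times> {..<n}" "\<lambda>(i, j). cmod (M $$ (i, j))"] by auto
  have "cmod ((M ^\<^sub>m k) $$ (i, j) / fact k) \<le> (real n * B) ^ k / fact k" for k
    using pow_mat_index_bound[OF M B ij] by (simp add: norm_divide divide_right_mono)
  moreover have "summable (\<lambda>k. (real n * B) ^ k / fact k)"
    using summable_exp_generic[of "real n * B"] by (simp add: divide_inverse_commute)
  ultimately show ?thesis by (rule summable_comparison_test'[where N = 0, rotated])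
qed

lemma pow_mat_eigenvector:
  fixes M :: "'a :: field mat"
  assumes M: "M \<in> carrier_mat n n" and v: "v \<in> carrier_vec n" and eig: "M *\<^sub>v v = \<mu> \<cdot>\<^sub>v v"
  shows "(M ^\<^sub>m k) *\<^sub>v v = \<mu> ^ k \<cdot>\<^sub>v v"
proof (induction k)
  case 0
  then show ?case using M v by simp
next
  case (Suc k)
  have "(M ^\<^sub>m Suc k) *\<^sub>v v = M ^\<^sub>m k *\<^sub>v (M *\<^sub>v v)"
    using M v by (simp add: assoc_mult_mat_vec[of _ n n _ n])
  also have "\<dots> = \<mu> \<cdot>\<^sub>v (M ^\<^sub>m k *\<^sub>v v)"
    unfolding eig using M v by (intro mult_mat_vec[of _ n n]) auto
  finally show ?case using Suc by (simp add: smult_smult_assoc)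
qed

lemma exp_mat_carrier: "M \<in> carrier_mat n n \<Longrightarrow> exp_mat M \<in> carrier_mat n n"
  by (auto simp: exp_mat_def)

text \<open>As the exponential is summed entrywise, the finite sum over \<open>j\<close> is
  exchanged with the series over \<open>k\<close>; each inner sum is then a coordinate of
  \<open>M ^\<^sub>m k *\<^sub>v v\<close>, which leaves the scalar series of
  \<open>exp \<mu>\<close>.\<close>

lemma exp_mat_eigenvector:
  assumes M: "M \<in> carrier_mat n n" and v: "v \<in> carrier_vec n" and eig: "M *\<^sub>v v = \<mu> \<cdot>\<^sub>v v"
  shows "exp_mat M *\<^sub>v v = exp \<mu> \<cdot>\<^sub>v v"
proof (rule eq_vecI)
  fix i assume "i < dim_vec (exp \<mu> \<cdot>\<^sub>v v)"
  then have i: "i < n" using v by simp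
  have coord: "(\<Sum>j<n. (M ^\<^sub>m k) $$ (i, j) * v $ j) = \<mu> ^ k * v $ i" for k
    using arg_cong[OF pow_mat_eigenvector[OF M v eig, of k], of "\<lambda>u. u $ i"] i M v
    by (simp add: scalar_prod_def atLeast0LessThan pow_mat_dim)
  have "(exp_mat M *\<^sub>v v) $ i = (\<Sum>j<n. (\<Sum>k. (M ^\<^sub>m k) $$ (i, j) / fact k) * v $ j)"
    using M i v by (simp add: exp_mat_def scalar_prod_def atLeast0LessThan)
  also have "\<dots> = (\<Sum>j<n. \<Sum>k. (M ^\<^sub>m k) $$ (i, j) / fact k * v $ j)"
    using summable_exp_mat_index[OF M i] by (intro sum.cong suminf_mult2) auto
  also have "\<dots> = (\<Sum>k. \<Sum>j<n. (M ^\<^sub>m k) $$ (i, j) / fact k * v $ j)"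
    using summable_exp_mat_index[OF M i] by (intro suminf_sum[symmetric] summable_mult2) auto
  also have "\<dots> = (\<Sum>k. \<mu> ^ k /\<^sub>R fact k * v $ i)"
  proof (rule suminf_cong)
    fix k
    have "(\<Sum>j<n. (M ^\<^sub>m k) $$ (i, j) / fact k * v $ j)
      = (\<Sum>j<n. (M ^\<^sub>m k) $$ (i, j) * v $ j) / fact k"
      by (simp add: sum_divide_distrib)
    then show "(\<Sum>j<n. (M ^\<^sub>m k) $$ (i, j) / fact k * v $ j) = \<mu> ^ k /\<^sub>R fact k * v $ i"
      unfolding coord by (simp add: scaleR_conv_of_real divide_inverse_commute)
  qed
  also have "\<dots> = exp \<mu> * v $ i"
    unfolding exp_def using summable_exp_generic by (rule suminf_mult2[symmetric])
  finally show "(exp_mat M *\<^sub>v v) $ i = (exp \<mu> \<cdot>\<^sub>v v) $ i" using i v by simp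
qed (use M v in \<open>auto simp: exp_mat_def\<close>)

section \<open>Symmetry of powers and exponentials\<close>

text \<open>Transposing \<open>A ^\<^sub>m k * A\<close> reverses the two factors; this commutation
  restores their order in \<open>symmetric_pow_mat\<close>.\<close>

lemma pow_mat_commute:
  fixes A :: "'a :: semiring_1 mat"
  assumes A: "A \<in> carrier_mat n n"
  shows "A * A ^\<^sub>m k = A ^\<^sub>m k * A"
proof (induction k)
  case (Suc k)
  have "A * (A ^\<^sub>m k * A) = A * A ^\<^sub>m k * A"
    using A by (intro assoc_mult_mat[symmetric, of _ n n _ n _ n]) auto
  then show ?case using Suc by simp
qed (use A in simp)

lemma symmetric_pow_mat:
  fixes A :: "'a :: comm_semiring_1 mat"
  assumes A: "A \<in> carrier_mat n n" and sym: "transpose_mat A = A"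
  shows "transpose_mat (A ^\<^sub>m k) = A ^\<^sub>m k"
proof (induction k)
  case (Suc k)
  have "transpose_mat (A ^\<^sub>m k * A) = transpose_mat A * transpose_mat (A ^\<^sub>m k)"
    using A by (intro transpose_mult[of _ n n _ n]) auto
  then show ?case using Suc sym pow_mat_commute[OF A] by simp
qed simp

lemma symmetric_exp_mat:
  assumes M: "M \<in> carrier_mat n n" and sym: "transpose_mat M = M"
  shows "transpose_mat (exp_mat M) = exp_mat M"
proof (rule eq_matI)
  fix i j assume "i < dim_row (exp_mat M)" "j < dim_col (exp_mat M)"
  then have ij: "i < n" "j < n" using M by (auto simp: exp_mat_def)
  have "(M ^\<^sub>m k) $$ (j, i) = (M ^\<^sub>m k) $$ (i, j)" for k
    using arg_cong[OF symmetric_pow_mat[OF M sym, of k], of "\<lambda>N. N $$ (i, j)"] ij M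
    by (simp add: pow_mat_dim)
  then show "transpose_mat (exp_mat M) $$ (i, j) = exp_mat M $$ (i, j)"
    using ij M by (simp add: exp_mat_def)
qed (auto simp: exp_mat_def)

section \<open>State transfer and eigenvectors\<close>

abbreviation evolution :: "real mat \<Rightarrow> real \<Rightarrow> complex mat" where
  "evolution K \<tau> \<equiv> exp_mat ((- \<i> * complex_of_real \<tau>) \<cdot>\<^sub>m map_mat complex_of_real K)"

lemma evolution_eigenvector:
  assumes K: "K \<in> carrier_mat n n" and w: "w \<in> carrier_vec n" and eig: "K *\<^sub>v w = \<theta> \<cdot>\<^sub>v w"
  shows "evolution K \<tau> *\<^sub>v map_vec complex_of_real w
    = cis (- \<tau> * \<theta>) \<cdot>\<^sub>v map_vec complex_of_real w"
proof -
  let ?K = "map_mat complex_of_real K" and ?w = "map_vec complex_of_real w"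
  have "?K *\<^sub>v ?w = complex_of_real \<theta> \<cdot>\<^sub>v ?w"
    using of_real_hom.mult_mat_vec_hom[OF K w, where 'a = complex] eig
    by (metis of_real_hom.vec_hom_smult)
  moreover have "(c \<cdot>\<^sub>m ?K) *\<^sub>v ?w = c \<cdot>\<^sub>v (?K *\<^sub>v ?w)" for c
    using K w by (intro eq_vecI) auto
  ultimately have "((- \<i> * complex_of_real \<tau>) \<cdot>\<^sub>m ?K) *\<^sub>v ?w
      = (- \<i> * complex_of_real \<tau> * complex_of_real \<theta>) \<cdot>\<^sub>v ?w"
    by (simp add: smult_smult_assoc)
  from exp_mat_eigenvector[OF _ _ this, of n] show ?thesis
    using K w by (simp add: cis_conv_exp mult.assoc)
qed

text \<open>By symmetry, row \<open>a - 1\<close> of the evolution matrix is its column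
  \<open>a - 1\<close>, which the transfer assumption identifies as \<gamma> times the vector of
  \<open>b\<close>. Pairing that row with \<open>w\<close> evaluates one coordinate of the evolved
  eigenvector in two ways.\<close>

lemma pst_phase:
  assumes K: "K \<in> carrier_mat n n" and w: "w \<in> carrier_vec n" and eig: "K *\<^sub>v w = \<theta> \<cdot>\<^sub>v w"
    and sym: "transpose_mat K = K" and ab: "a \<in> {1..n}" "b \<in> {1..n}"
    and transfer: "evolution K \<tau> *\<^sub>v vertex_vec n a = \<gamma> \<cdot>\<^sub>v vertex_vec n b"
  shows "cis (- \<tau> * \<theta>) * w $ (a - 1) = \<gamma> * w $ (b - 1)"
proof -
  let ?E = "evolution K \<tau>" and ?w = "map_vec complex_of_real w"
  let ?M = "(- \<i> * complex_of_real \<tau>) \<cdot>\<^sub>m map_mat complex_of_real K"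
  have a: "a - 1 < n" and b: "b - 1 < n" using ab by auto
  have M: "?M \<in> carrier_mat n n" using K by simp
  have E: "?E \<in> carrier_mat n n" using M by (rule exp_mat_carrier)
  have "transpose_mat ?M = ?M"
    using K index_transpose_mat(1)[of _ K _, unfolded sym] by (intro eq_matI) auto
  then have symE: "transpose_mat ?E = ?E" by (rule symmetric_exp_mat[OF M])
  have w': "?w \<in> carrier_vec n" using w by simp
  have "row ?E (a - 1) = col ?E (a - 1)"
    using E a symE by (metis carrier_matD(1) row_transpose carrier_matD(2))
  also have "\<dots> = ?E *\<^sub>v vertex_vec n a"
    unfolding vertex_vec_def using E a by (intro eq_vecI) auto
  finally have row: "row ?E (a - 1) = \<gamma> \<cdot>\<^sub>v vertex_vec n b" using transfer by simp
  have "cis (- \<tau> * \<theta>) * ?w $ (a - 1) = (?E *\<^sub>v ?w) $ (a - 1)"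
    using evolution_eigenvector[OF K w eig] w a by simp
  also have "\<dots> = (\<gamma> \<cdot>\<^sub>v vertex_vec n b) \<bullet> ?w"
    using E a row by simp
  also have "\<dots> = \<gamma> * ?w $ (b - 1)"
    unfolding vertex_vec_def using w' b by simp
  finally show ?thesis using w a b by simp
qed

text \<open>The sign, and with it the parity of \<open>n\<close>, is deliberately forgotten: the
  later arguments only compare integer multiples of \<pi>.\<close>

lemma cis_eq_imp_int_multiple_pi:
  assumes "cis x = cis y \<or> cis x = - cis y"
  obtains n :: int where "x - y = of_int n * pi"
proof -
  have "cis (x - y) = 1 \<or> cis (x - y) = - 1"
    using assms by (auto simp flip: cis_divide)
  then have "sin (x - y) = 0"
    by (metis cis.simps(2) one_complex.simps(2) uminus_complex.simps(2) neg_0_equal_iff_equal)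
  then show thesis using that by (auto simp: sin_zero_iff_int2)
qed

section \<open>Paths\<close>

lemma path_mat_carrier: "path_mat n \<in> carrier_mat n n"
  by (simp add: path_mat_def adjacency_mat_def)

lemma path_mat_symmetric: "transpose_mat (path_mat n) = path_mat n"
  by (intro eq_matI) (auto simp: path_mat_def adjacency_mat_def path_adj_def)

text \<open>Extending \<open>f\<close> by zero to the virtual vertices \<open>0\<close> and
  \<open>n + 1\<close> gives every vertex two neighbours. Row \<open>i\<close> belongs to vertex
  \<open>i + 1\<close>, whose neighbours are \<open>i\<close> and \<open>i + 2\<close>.\<close>

lemma path_mat_mult_vec:
  assumes "f 0 = 0" "f (n + 1) = 0"
  shows "path_mat n *\<^sub>v vec n (\<lambda>i. f (i + 1)) = vec n (\<lambda>i. f i + f (i + 2))"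
proof (rule eq_vecI)
  fix i assume "i < dim_vec (vec n (\<lambda>i. f i + f (i + 2)))"
  then have i: "i < n" by simp
  have "(path_mat n *\<^sub>v vec n (\<lambda>i. f (i + 1))) $ i
      = (\<Sum>j<n. if path_adj (i + 1) (j + 1) then f (j + 1) else 0)"
    using i by (auto simp: path_mat_def adjacency_mat_def scalar_prod_def atLeast0LessThan
        intro!: sum.cong)
  also have "\<dots> = (\<Sum>j\<in>{1..n}. if path_adj (i + 1) j then f j else 0)"
    by (rule sum.reindex_bij_witness[of _ "\<lambda>j. j - 1" "\<lambda>j. j + 1"]) auto
  also have "\<dots> = (\<Sum>j\<in>{0..n + 1}. if path_adj (i + 1) j then f j else 0)"
    using assms by (intro sum.mono_neutral_left) (auto simp: not_le Suc_le_eq le_Suc_eq)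
  also have "\<dots> = (\<Sum>j\<in>{i, i + 2}. if path_adj (i + 1) j then f j else 0)"
    using i by (intro sum.mono_neutral_right) (auto simp: path_adj_def)
  also have "\<dots> = f i + f (i + 2)" by (simp add: path_adj_def)
  finally show "(path_mat n *\<^sub>v vec n (\<lambda>i. f (i + 1))) $ i = vec n (\<lambda>i. f i + f (i + 2)) $ i"
    using i by simp
qed (simp add: path_mat_def adjacency_mat_def)

text \<open>The addition formulas give the three-term recurrence; the hypothesis is the boundary
  condition at the virtual vertex \<open>n + 1\<close>.\<close>

lemma path_mat_eigenvector:
  assumes "sin (real (n + 1) * x) = 0"
  shows "path_mat n *\<^sub>v vec n (\<lambda>i. sin (real (i + 1) * x))
    = (2 * cos x) \<cdot>\<^sub>v vec n (\<lambda>i. sin (real (i + 1) * x))"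
proof -
  have "sin (real i * x) + sin (real (i + 2) * x) = 2 * cos x * sin (real (i + 1) * x)" for i
    using sin_add[of "real (i + 1) * x" x] sin_diff[of "real (i + 1) * x" x]
    by (simp add: algebra_simps)
  then show ?thesis
    using path_mat_mult_vec[of "\<lambda>i. sin (real i * x)" n] assms by (auto intro!: eq_vecI)
qed

lemma path_7_phase:
  assumes "evolution (path_mat 7 ^\<^sub>m k) \<tau> *\<^sub>v vertex_vec 7 2 = \<gamma> \<cdot>\<^sub>v vertex_vec 7 6"
    and "sin (8 * x) = 0"
  shows "cis (- \<tau> * (2 * cos x) ^ k) * sin (2 * x) = \<gamma> * sin (6 * x)"
  using pst_phase[of "path_mat 7 ^\<^sub>m k" 7 "vec 7 (\<lambda>i. sin (real (i + 1) * x))" "(2 * cos x) ^ k" 2 6 \<tau> \<gamma>]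
    pow_mat_eigenvector[OF path_mat_carrier _ path_mat_eigenvector[of 7 x], of k] assms
    symmetric_pow_mat[OF path_mat_carrier path_mat_symmetric, of 7 k]
  by (simp add: path_mat_carrier)

text \<open>At \<open>x = pi / 8\<close> and \<open>x = 3 * pi / 8\<close> the values
  \<open>sin (2 * x)\<close> and \<open>sin (6 * x)\<close> coincide, at \<open>x = pi / 4\<close>
  they are opposite. The case \<open>\<epsilon> = - 1\<close> comes from \<open>pi - x\<close>,
  which negates the eigenvalue and both sines.\<close>

lemma path_7_phases:
  assumes transfer: "evolution (path_mat 7 ^\<^sub>m k) \<tau> *\<^sub>v vertex_vec 7 2 = \<gamma> \<cdot>\<^sub>v vertex_vec 7 6"
    and \<epsilon>: "\<epsilon> = 1 \<or> \<epsilon> = - 1"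
  shows "cis (- \<tau> * (\<epsilon> * (2 * cos (pi / 8))) ^ k) = \<gamma>"
    and "cis (- \<tau> * (\<epsilon> * sqrt 2) ^ k) = - \<gamma>"
    and "cis (- \<tau> * (\<epsilon> * (2 * cos (3 * pi / 8))) ^ k) = \<gamma>"
proof -
  have phase: "cis (- \<tau> * (\<epsilon> * (2 * cos x)) ^ k) * sin (2 * x) = \<gamma> * sin (6 * x)"
    if "sin (8 * x) = 0" for x
  proof -
    \<comment> \<open>Used with \<open>m = 1\<close> and \<open>m = 3\<close> for the two entries
      and with \<open>m = 4\<close> for the boundary condition.\<close>
    have reflect: "sin (2 * of_int m * (pi - x)) = - sin (2 * of_int m * x)" for m :: int
      using sin_diff[of "of_int m * (2 * pi)" "2 * of_int m * x"] sin_int_2pin[of m] cos_int_2pin[of m]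
      by (simp add: algebra_simps)
    show ?thesis
      using \<epsilon> path_7_phase[OF transfer that] path_7_phase[OF transfer, of "pi - x"]
        reflect[of 1] reflect[of 3] reflect[of 4] that
      by auto
  qed
  have sin_34: "sin (3 * pi / 4) = sin (pi / 4)"
    using sin_pi_minus[of "pi / 4"] by (simp add: field_simps)
  have sin_94: "sin (9 * pi / 4) = sin (pi / 4)"
    using sin_periodic[of "pi / 4"] by (simp add: field_simps)
  have sin_32: "sin (3 * pi / 2) = - 1"
    using sin_3over2_pi by (simp add: field_simps)
  have sin_nz: "sin (pi / 4) \<noteq> 0" by (simp add: sin_45)
  show "cis (- \<tau> * (\<epsilon> * (2 * cos (pi / 8))) ^ k) = \<gamma>"
    using phase[of "pi / 8"] sin_34 sin_nz by (simp add: field_simps)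
  show "cis (- \<tau> * (\<epsilon> * sqrt 2) ^ k) = - \<gamma>"
    using phase[of "pi / 4"] sin_32 by (simp add: cos_45 field_simps)
  show "cis (- \<tau> * (\<epsilon> * (2 * cos (3 * pi / 8))) ^ k) = \<gamma>"
    using phase[of "3 * pi / 8"] sin_34 sin_94 sin_nz
    by (simp add: field_simps)
qed

section \<open>Arithmetic of the eigenvalues\<close>

text \<open>Irrationality of \<open>sqrt 2\<close> in integer form: in
  \<open>p\<^sup>2 = 2 * q\<^sup>2\<close> the exponent of 2 would be even on the left and odd on
  the right.\<close>

lemma int_eq_int_mult_sqrt2_imp_eq_0:
  assumes "of_int p = of_int q * sqrt 2"
  shows "q = 0"
proof (rule ccontr)
  assume q: "q \<noteq> 0"
  have "real_of_int (p\<^sup>2) = of_int (2 * q\<^sup>2)"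
    using assms by (simp add: power_mult_distrib)
  then have "p\<^sup>2 = 2 * q\<^sup>2" by (simp only: of_int_eq_iff)
  moreover from this q have "p \<noteq> 0" by auto
  moreover have "prime_elem (2 :: int)" by simp
  ultimately have "2 * multiplicity 2 p = 1 + 2 * multiplicity 2 q"
    using q by (metis prime_elem_multiplicity_mult_distrib prime_elem_multiplicity_power_distrib
        multiplicity_self prime_elem_not_zeroI prime_elem_not_unit power_not_zero)
  then show False by presburger
qed

text \<open>The coefficients obey \<open>(a, b) \<mapsto> (c * a + 2 * b, c * b + a)\<close>, and
  the term \<open>2 * b\<close> makes \<open>a\<close> exceed \<open>c ^ k\<close> from the second
  power on. Odd powers of the path use \<open>c = 1\<close>, even ones \<open>c = 2\<close>.\<close>

lemma conjugate_power:
  fixes c :: nat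
  assumes "k \<ge> 1" "c \<ge> 1"
  obtains a b :: nat where "(c + sqrt 2) ^ k = a + b * sqrt 2" "(c - sqrt 2) ^ k = a - b * sqrt 2"
    "b \<ge> 1" "a \<ge> c ^ k" "k \<ge> 2 \<Longrightarrow> a > c ^ k"
proof -
  have "\<exists>a b :: nat. (c + sqrt 2) ^ k = a + b * sqrt 2 \<and> (c - sqrt 2) ^ k = a - b * sqrt 2 \<and>
     b \<ge> 1 \<and> a \<ge> c ^ k \<and> (k \<ge> 2 \<longrightarrow> a > c ^ k)"
    using assms(1)
  proof (induction k rule: dec_induct)
    case base
    show ?case by (intro exI[of _ c] exI[of _ 1]) auto
  next
    case (step k)
    then obtain a b :: nat where ab: "(c + sqrt 2) ^ k = a + b * sqrt 2"
      "(c - sqrt 2) ^ k = a - b * sqrt 2" "b \<ge> 1" "a \<ge> c ^ k" by auto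
    have "c * c ^ k \<le> c * a" using ab(4) by (rule mult_le_mono2)
    then have ca: "c ^ Suc k < c * a + 2 * b" unfolding power_Suc using ab(3) by linarith
    have cb: "1 \<le> c * b + a" using ab(3) assms(2) by (simp add: Suc_le_eq)
    have expand: "(c + sqrt 2) ^ Suc k = (c * a + 2 * b) + (c * b + a) * sqrt 2"
      "(c - sqrt 2) ^ Suc k = (c * a + 2 * b) - (c * b + a) * sqrt 2"
      unfolding power_Suc ab(1,2) by (simp_all add: algebra_simps)
    show ?case
      by (rule exI[of _ "c * a + 2 * b"], rule exI[of _ "c * b + a"])
        (intro conjI impI expand cb ca less_imp_le)
  qed
  then show thesis using that by blast
qed

lemma cos_pi_eighth_sq:
  "(2 * cos (pi / 8))\<^sup>2 = 2 + sqrt 2" "(2 * cos (3 * pi / 8))\<^sup>2 = 2 - sqrt 2"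
proof -
  show "(2 * cos (pi / 8))\<^sup>2 = 2 + sqrt 2"
    using cos_double_cos[of "pi / 8"] by (simp add: cos_45 power_mult_distrib)
  have "cos (3 * pi / 4) = - cos (pi / 4)"
    using cos_pi_minus[of "pi / 4"] by (simp add: field_simps)
  then show "(2 * cos (3 * pi / 8))\<^sup>2 = 2 - sqrt 2"
    using cos_double_cos[of "3 * pi / 8"] by (simp add: cos_45 power_mult_distrib)
qed

text \<open>Both sides are nonnegative and have square \<open>2 + sqrt 2\<close>. The ratio thus has
  the form treated by \<open>conjugate_power\<close>.\<close>

lemma cos_pi_eighth_ratio: "2 * cos (pi / 8) = (1 + sqrt 2) * (2 * cos (3 * pi / 8))"
proof (rule power2_eq_imp_eq)
  have "((1 + sqrt 2) * (2 * cos (3 * pi / 8)))\<^sup>2 = (1 + sqrt 2)\<^sup>2 * (2 - sqrt 2)"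
    by (metis cos_pi_eighth_sq(2) power_mult_distrib)
  also have "\<dots> = 2 + sqrt 2" by (simp add: power2_eq_square algebra_simps)
  finally show "(2 * cos (pi / 8))\<^sup>2 = ((1 + sqrt 2) * (2 * cos (3 * pi / 8)))\<^sup>2"
    by (simp only: cos_pi_eighth_sq)
  have "cos (pi / 8) \<ge> 0" "cos (3 * pi / 8) \<ge> 0" by (auto intro!: cos_ge_zero)
  then show "0 \<le> 2 * cos (pi / 8)" "0 \<le> (1 + sqrt 2) * (2 * cos (3 * pi / 8))" by auto
qed

section \<open>The powers of \<open>P\<^sub>7\<close>\<close>

text \<open>For odd \<open>k\<close> the opposite eigenvalues share the phase \<gamma>, so doubling
  \<tau> times each outer eigenvalue gives an integer multiple of \<pi>. The irrational ratio of the
  two forces the smaller multiple to vanish, against positivity.\<close>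

lemma path_7_no_transfer_odd:
  assumes k: "odd k" and \<tau>: "\<tau> > 0"
  shows "evolution (path_mat 7 ^\<^sub>m k) \<tau> *\<^sub>v vertex_vec 7 2 \<noteq> \<gamma> \<cdot>\<^sub>v vertex_vec 7 6"
proof
  assume transfer: "evolution (path_mat 7 ^\<^sub>m k) \<tau> *\<^sub>v vertex_vec 7 2 = \<gamma> \<cdot>\<^sub>v vertex_vec 7 6"
  \<comment> \<open>Facts 1 to 3 concern the positive eigenvalues, facts 4 to 6 their
    negatives.\<close>
  note ph = path_7_phases[OF transfer, of 1, simplified] path_7_phases[OF transfer, of "- 1"]
  define s where "s = (2 * cos (3 * pi / 8)) ^ k"
  have "cos (3 * pi / 8) > 0" by (intro cos_gt_zero) auto
  then have s: "s > 0" by (simp add: s_def)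
  obtain a b :: nat where ab: "(1 + sqrt 2) ^ k = a + b * sqrt 2" "b \<ge> 1"
    using conjugate_power[of k 1] odd_pos[OF k] by (metis One_nat_def Suc_leI le_refl of_nat_1)
  have r: "(2 * cos (pi / 8)) ^ k = (a + b * sqrt 2) * s"
    by (simp only: cos_pi_eighth_ratio power_mult_distrib[of "1 + sqrt 2"] ab s_def)
  have minus: "(- 1 * t) ^ k = - (t ^ k)" for t :: real using k by simp
  obtain p :: int where p: "\<tau> * s + \<tau> * s = of_int p * pi"
    using cis_eq_imp_int_multiple_pi[of "\<tau> * s" "- (\<tau> * s)"] ph(3) ph(6)[unfolded minus]
    by (auto simp: s_def)
  obtain q :: int where q: "\<tau> * ((a + b * sqrt 2) * s) + \<tau> * ((a + b * sqrt 2) * s) = of_int q * pi"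
    using cis_eq_imp_int_multiple_pi[of "\<tau> * ((a + b * sqrt 2) * s)" "- (\<tau> * ((a + b * sqrt 2) * s))"]
      ph(1) ph(4)[unfolded minus] r by auto
  have "of_int q * pi = (a + b * sqrt 2) * (of_int p * pi)"
    unfolding q[symmetric] p[symmetric] by (simp add: algebra_simps)
  then have "of_int q = (a + b * sqrt 2) * of_int p" by simp
  then have "of_int (q - int a * p) = of_int (int b * p) * sqrt 2" by (simp add: algebra_simps)
  then have "int b * p = 0" by (rule int_eq_int_mult_sqrt2_imp_eq_0)
  then have "p = 0" using ab(2) by simp
  then show False using p s \<tau> by simp
qed

text \<open>The phases at the three eigenvalues agree up to sign. Besides excluding
  \<open>m \<ge> 2\<close>, the case \<open>m = 1\<close> bounds the transfer time from
  below.\<close>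

lemma path_7_even_gaps:
  assumes "evolution (path_mat 7 ^\<^sub>m (2 * m)) \<tau> *\<^sub>v vertex_vec 7 2 = \<gamma> \<cdot>\<^sub>v vertex_vec 7 6"
  obtains p q :: int where "\<tau> * ((2 + sqrt 2) ^ m - 2 ^ m) = of_int p * pi"
    "\<tau> * (2 ^ m - (2 - sqrt 2) ^ m) = of_int q * pi"
proof -
  have ph': "cis (- (\<tau> * (2 + sqrt 2) ^ m)) = \<gamma>" "cis (- (\<tau> * 2 ^ m)) = - \<gamma>"
    "cis (- (\<tau> * (2 - sqrt 2) ^ m)) = \<gamma>"
    using path_7_phases[OF assms, of 1] unfolding mult_1 power_mult cos_pi_eighth_sq by simp_all
  obtain p :: int where "- (\<tau> * 2 ^ m) - - (\<tau> * (2 + sqrt 2) ^ m) = of_int p * pi"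
    using cis_eq_imp_int_multiple_pi ph' by metis
  moreover obtain q :: int where "- (\<tau> * (2 - sqrt 2) ^ m) - - (\<tau> * 2 ^ m) = of_int q * pi"
    using cis_eq_imp_int_multiple_pi ph' minus_minus by metis
  ultimately show thesis using that by (simp add: algebra_simps)
qed

text \<open>The two gaps have sum \<open>2 * b * sqrt 2\<close> and difference \<open>2 * d\<close>,
  where \<open>d > 0\<close> because \<open>m \<ge> 2\<close>. Eliminating \<tau> leaves an integer
  relation with \<open>sqrt 2\<close> that forces \<open>p = q\<close>, hence a zero
  difference.\<close>

lemma path_7_no_transfer_even:
  assumes m: "m \<ge> 2" and \<tau>: "\<tau> > 0"
  shows "evolution (path_mat 7 ^\<^sub>m (2 * m)) \<tau> *\<^sub>v vertex_vec 7 2 \<noteq> \<gamma> \<cdot>\<^sub>v vertex_vec 7 6"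
proof
  assume "evolution (path_mat 7 ^\<^sub>m (2 * m)) \<tau> *\<^sub>v vertex_vec 7 2 = \<gamma> \<cdot>\<^sub>v vertex_vec 7 6"
  then obtain p q :: int where pq: "\<tau> * ((2 + sqrt 2) ^ m - 2 ^ m) = of_int p * pi"
    "\<tau> * (2 ^ m - (2 - sqrt 2) ^ m) = of_int q * pi"
    by (rule path_7_even_gaps)
  obtain a b :: nat where ab: "(2 + sqrt 2) ^ m = a + b * sqrt 2" "(2 - sqrt 2) ^ m = a - b * sqrt 2"
    "b \<ge> 1" "a > 2 ^ m"
    using conjugate_power[of m 2] m by auto
  define d where "d = int a - 2 ^ m"
  have d: "d > 0" "real_of_int d = real a - 2 ^ m" using ab(4) by (auto simp: d_def)
  have sum: "2 * \<tau> * b * sqrt 2 = of_int (p + q) * pi"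
    and diff: "2 * \<tau> * of_int d = of_int (p - q) * pi"
    using pq unfolding ab(1,2) d(2) by (simp_all add: algebra_simps)
  have "of_int (p + q) * of_int d * pi = 2 * \<tau> * of_int d * b * sqrt 2"
    using arg_cong[OF sum, of "\<lambda>t. of_int d * t"] by (simp only: mult_ac)
  also have "\<dots> = of_int (p - q) * b * sqrt 2 * pi" unfolding diff by simp
  finally have "of_int ((p + q) * d) = of_int ((p - q) * int b) * sqrt 2" by simp
  then have "(p - q) * int b = 0" by (rule int_eq_int_mult_sqrt2_imp_eq_0)
  then have "p - q = 0" using ab(3) by simp
  then show False using diff \<tau> d(1) by simp
qed

section \<open>Transfer under the square\<close>

text \<open>Two steps along the path preserve the parity of a vertex, so the square acts on the
  vertices 2, 4, 6 alone; these are the list positions 1, 3, 5.\<close>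

lemma path_7_square_mult_vec:
  "path_mat 7 ^\<^sub>m 2 *\<^sub>v vec 7 (\<lambda>i. [0, p, 0, q, 0, r, 0] ! i)
    = vec 7 (\<lambda>i. [0, 2 * p + q, 0, p + 2 * q + r, 0, q + 2 * r, 0] ! i)"
proof -
  have less_7: "i < 7 \<longleftrightarrow> i \<in> {0, 1, 2, 3, 4, 5, 6}" for i :: nat by auto
  have step: "path_mat 7 *\<^sub>v vec 7 (\<lambda>i. [y1, y2, y3, y4, y5, y6, y7] ! i)
    = vec 7 (\<lambda>i. [y2, y1 + y3, y2 + y4, y3 + y5, y4 + y6, y5 + y7, y6] ! i)" for y1 y2 y3 y4 y5 y6 y7
  proof -
    \<comment> \<open>The zeros at positions 0 and 8 are the virtual end vertices.\<close>
    let ?f = "\<lambda>i. [0, y1, y2, y3, y4, y5, y6, y7, 0] ! i"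
    have "path_mat 7 *\<^sub>v vec 7 (\<lambda>i. ?f (i + 1)) = vec 7 (\<lambda>i. ?f i + ?f (i + 2))"
      by (rule path_mat_mult_vec) simp_all
    moreover have "vec 7 (\<lambda>i. ?f (i + 1)) = vec 7 (\<lambda>i. [y1, y2, y3, y4, y5, y6, y7] ! i)"
      "vec 7 (\<lambda>i. ?f i + ?f (i + 2))
        = vec 7 (\<lambda>i. [y2, y1 + y3, y2 + y4, y3 + y5, y4 + y6, y5 + y7, y6] ! i)"
      by (auto simp: vec_eq_iff less_7)
    ultimately show ?thesis by (simp only:)
  qed
  have "path_mat 7 ^\<^sub>m 2 *\<^sub>v v = path_mat 7 *\<^sub>v (path_mat 7 *\<^sub>v v)" if "v \<in> carrier_vec 7" for v
    using that path_mat_carrier[of 7]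
    by (simp add: numeral_2_eq_2 assoc_mult_mat_vec[of _ 7 7 _ 7])
  then show ?thesis by (simp add: step) (auto simp: vec_eq_iff less_7)
qed

text \<open>On the vertices 2, 4, 6 the eigenvectors are \<open>(1, sqrt 2, 1)\<close>,
  \<open>(1, - sqrt 2, 1)\<close> and \<open>(1, 0, - 1)\<close>. At this time the two symmetric
  ones acquire a sign relative to the antisymmetric one, which mirrors vertex 2 to vertex 6 up to a
  phase.\<close>

lemma path_7_square_transfer:
  "evolution (path_mat 7 ^\<^sub>m 2) (pi / sqrt 2) *\<^sub>v vertex_vec 7 2
    = - cis (- (pi / sqrt 2) * 2) \<cdot>\<^sub>v vertex_vec 7 6"
proof -
  let ?E = "evolution (path_mat 7 ^\<^sub>m 2) (pi / sqrt 2)" and ?c = "cis (- (pi / sqrt 2) * 2)"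
  define u where "u p q r = map_vec complex_of_real (vec 7 (\<lambda>i. [0, p, 0, q, 0, r, 0] ! i))" for p q r
  have less_7: "i < 7 \<longleftrightarrow> i \<in> {0, 1, 2, 3, 4, 5, 6}" for i :: nat by auto
  have K: "path_mat 7 ^\<^sub>m 2 \<in> carrier_mat 7 7"
    using path_mat_carrier[of 7] by simp
  then have E: "?E \<in> carrier_mat 7 7" by (intro exp_mat_carrier) simp
  have u: "u p q r \<in> carrier_vec 7" for p q r by (simp add: u_def)
  have eig: "?E *\<^sub>v u p q r = cis (- (pi / sqrt 2) * \<theta>) \<cdot>\<^sub>v u p q r"
    if "2 * p + q = \<theta> * p" "p + 2 * q + r = \<theta> * q" "q + 2 * r = \<theta> * r" for p q r \<theta>
    unfolding u_def
    by (rule evolution_eigenvector[OF K])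
      (use that in \<open>auto simp: path_7_square_mult_vec vec_eq_iff less_7\<close>)
  \<comment> \<open>A shift of the eigenvalue by \<open>sqrt 2\<close> in either direction turns the
    phase by exactly \<pi>.\<close>
  have half_turn: "cis (- (pi / sqrt 2) * (2 + sqrt 2)) = - ?c"
    "cis (- (pi / sqrt 2) * (2 - sqrt 2)) = - ?c"
    using cis_mult[of "- (pi / sqrt 2) * 2" pi] cis_mult[of "- (pi / sqrt 2) * 2" "- pi"]
    by (simp_all add: algebra_simps flip: cis_cnj)
  have eigs: "?E *\<^sub>v u 1 (sqrt 2) 1 = - ?c \<cdot>\<^sub>v u 1 (sqrt 2) 1"
    "?E *\<^sub>v u 1 (- sqrt 2) 1 = - ?c \<cdot>\<^sub>v u 1 (- sqrt 2) 1"
    "?E *\<^sub>v u 1 0 (- 1) = ?c \<cdot>\<^sub>v u 1 0 (- 1)"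
    using eig[of 1 "sqrt 2" "2 + sqrt 2" 1] eig[of 1 "- sqrt 2" "2 - sqrt 2" 1] eig[of 1 0 2 "- 1"]
    unfolding half_turn by (simp_all add: algebra_simps)
  \<comment> \<open>Adding the two symmetric eigenvectors cancels their middle entries.\<close>
  have e\<^sub>2: "vertex_vec 7 2
      = (1 / 4) \<cdot>\<^sub>v (u 1 (sqrt 2) 1 + u 1 (- sqrt 2) 1) + (1 / 2) \<cdot>\<^sub>v u 1 0 (- 1)"
    by (auto simp: vertex_vec_def u_def vec_eq_iff less_7)
  have linear: "F *\<^sub>v ((1 / 4) \<cdot>\<^sub>v (x + y) + (1 / 2) \<cdot>\<^sub>v z)
      = (1 / 4) \<cdot>\<^sub>v (F *\<^sub>v x + F *\<^sub>v y) + (1 / 2) \<cdot>\<^sub>v (F *\<^sub>v z)"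
    if "F \<in> carrier_mat 7 7" "x \<in> carrier_vec 7" "y \<in> carrier_vec 7" "z \<in> carrier_vec 7"
    for F :: "complex mat" and x y z
    using that by (simp add: mult_add_distrib_mat_vec[of F 7 7] mult_mat_vec[of F 7 7])
  have "?E *\<^sub>v vertex_vec 7 2
      = (1 / 4) \<cdot>\<^sub>v (?E *\<^sub>v u 1 (sqrt 2) 1 + ?E *\<^sub>v u 1 (- sqrt 2) 1)
        + (1 / 2) \<cdot>\<^sub>v (?E *\<^sub>v u 1 0 (- 1))"
    unfolding e\<^sub>2 by (rule linear[OF E u u u])
  also have "\<dots> = - ?c \<cdot>\<^sub>v vertex_vec 7 6"
    unfolding eigs by (auto simp: vertex_vec_def u_def vec_eq_iff less_7)
  finally show ?thesis .
qed

theorem theorem6p2: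
  "pst_powers (path_mat 7) 2 6 = {2} \<and>
   pst_at (path_mat 7 ^\<^sub>m 2) 2 6 (pi / sqrt 2) \<and>
   (\<forall>\<tau>. pst_at (path_mat 7 ^\<^sub>m 2) 2 6 \<tau> \<longrightarrow> pi / sqrt 2 \<le> \<tau>)"
proof (intro conjI)
  have dim: "dim_row (path_mat 7 ^\<^sub>m k) = 7" for k
    using path_mat_carrier[of 7] by (simp add: pow_mat_dim)
  have transfer: "\<tau> > 0 \<and> (\<exists>\<gamma>. evolution (path_mat 7 ^\<^sub>m k) \<tau> *\<^sub>v vertex_vec 7 2
      = \<gamma> \<cdot>\<^sub>v vertex_vec 7 6)" if "pst_at (path_mat 7 ^\<^sub>m k) 2 6 \<tau>" for k \<tau>
    using that unfolding pst_at_def dim Let_def by auto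
  show two: "pst_at (path_mat 7 ^\<^sub>m 2) 2 6 (pi / sqrt 2)"
    unfolding pst_at_def dim Let_def
    using path_7_square_transfer path_mat_carrier[of 7]
      symmetric_pow_mat[OF path_mat_carrier path_mat_symmetric]
    by (auto intro!: exI[of _ "- cis (- (pi / sqrt 2) * 2)"])
  have "k = 2" if k: "k \<ge> 1" "pst (path_mat 7 ^\<^sub>m k) 2 6" for k
  proof (rule ccontr)
    assume "k \<noteq> 2"
    obtain \<tau> \<gamma> where "\<tau> > 0"
      "evolution (path_mat 7 ^\<^sub>m k) \<tau> *\<^sub>v vertex_vec 7 2 = \<gamma> \<cdot>\<^sub>v vertex_vec 7 6"
      using k(2) transfer unfolding pst_def by blast
    then have "even k" using path_7_no_transfer_odd by blast
    then obtain m where m: "k = 2 * m" by blast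
    then have "m \<ge> 2" using k(1) \<open>k \<noteq> 2\<close> by auto
    then show False using path_7_no_transfer_even \<open>\<tau> > 0\<close> m
      \<open>evolution (path_mat 7 ^\<^sub>m k) \<tau> *\<^sub>v vertex_vec 7 2 = \<gamma> \<cdot>\<^sub>v vertex_vec 7 6\<close> by blast
  qed
  then show "pst_powers (path_mat 7) 2 6 = {2}"
    using two unfolding pst_powers_def pst_def by auto
  show "\<forall>\<tau>. pst_at (path_mat 7 ^\<^sub>m 2) 2 6 \<tau> \<longrightarrow> pi / sqrt 2 \<le> \<tau>"
  proof (intro allI impI)
    fix \<tau> assume "pst_at (path_mat 7 ^\<^sub>m 2) 2 6 \<tau>"
    \<comment> \<open>Writing the exponent as \<open>2 * 1\<close> matches
      \<open>path_7_even_gaps\<close>, whose first gap is then \<open>sqrt 2\<close>; positivity of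
      \<tau> excludes multiples below \<pi>.\<close>
    then obtain \<gamma> where \<tau>: "\<tau> > 0"
      and "evolution (path_mat 7 ^\<^sub>m (2 * 1)) \<tau> *\<^sub>v vertex_vec 7 2 = \<gamma> \<cdot>\<^sub>v vertex_vec 7 6"
      using transfer by fastforce
    from this(2) obtain p :: int where p: "\<tau> * sqrt 2 = of_int p * pi"
      by (rule path_7_even_gaps) simp
    then have "of_int p * pi > 0" using \<tau> by (metis mult_pos_pos real_sqrt_gt_zero zero_less_numeral)
    then have "p \<ge> 1" by (simp add: zero_less_mult_iff)
    then have "1 * pi \<le> of_int p * pi" by (intro mult_right_mono) auto
    then show "pi / sqrt 2 \<le> \<tau>" using p by (simp add: divide_le_eq)
  qed
qed

end
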